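(* Let $({\bf v}_n)_{n\ge 0}$ be a sequence in $\mathbb{R}^2$ generated by the ideal iterative rule (defined in the context) from some ${\bf v}_0\in\mathbb{R}^2$. For every $n\ge 0$, if ${\bf v}_n\in\mathcal{Z}_{12}$ then ${\bf v}_{n+1}\notin\mathcal{Z}_{12}$.
   Context: A rigid disk is simultaneously in contact with two walls forming a corner of angle $2\alpha\in(0,\pi)$; put $k=\tan\alpha>0$. The linear velocity of the disk is a pair $(\dot x,\dot y)\in\mathbb{R}^2$. The plane of velocities is partitioned into four zones: $\mathcal{Z}_0=\{k\dot x+\dot y\le 0,\ k\dot x-\dot y\le 0\}$ (exit velocities), $\mathcal{Z}_1=\{k\dot x+\dot y\le 0,\ k\dot x-\dot y>0\}$ (impact with the first wall only), $\mathcal{Z}_2=\{k\dot x+\dot y>0,\ k\dot x-\dot y\le 0\}$ (impact with the second wall only), $\mathcal{Z}_{12}=\{k\dot x+\dot y>0,\ k\dot x-\dot y>0\}$ (multiple impact). Ideal iterative rule. Given ${\bf v}_n=(\dot x_n,\dot y_n)$, define ${\bf v}_{n+1}=(\dot x_{n+1},\dot y_{n+1})$ by: - if ${\bf v}_n\in\mathcal{Z}_0$: ${\bf v}_{n+1}={\bf v}_n$; - if ${\bf v}_n\in\mathcal{Z}_1$: $\dot x_{n+1}=\frac{1-k^2}{1+k^2}\dot x_n+\frac{2k}{1+k^2}\dot y_n$, $\ \dot y_{n+1}=\frac{2k}{1+k^2}\dot x_n-\frac{1-k^2}{1+k^2}\dot y_n$; - if ${\bf v}_n\in\mathcal{Z}_2$: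 $\dot x_{n+1}=\frac{1-k^2}{1+k^2}\dot x_n-\frac{2k}{1+k^2}\dot y_n$, $\ \dot y_{n+1}=-\frac{2k}{1+k^2}\dot x_n-\frac{1-k^2}{1+k^2}\dot y_n$; - if ${\bf v}_n\in\mathcal{Z}_{12}$: $\dot x_{n+1}=\frac{-k^4\dot x_n^2+(1-2k^2)\dot y_n^2}{k^4\dot x_n^2+\dot y_n^2}\,\dot x_n$, $\ \dot y_{n+1}=\frac{k^2(k^2-2)\dot x_n^2-\dot y_n^2}{k^4\dot x_n^2+\dot y_n^2}\,\dot y_n$. *)

theory Defs
  imports Complex_Main
begin

text \<open>
  A velocity of the disk is the pair of its Cartesian components.
  Throughout, \<open>k\<close> stands for \<open>tan \<alpha>\<close>, where \<open>2 * \<alpha>\<close> is the angle of the corner.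
\<close>

definition zone0 :: "real \<Rightarrow> (real \<times> real) set" where
  "zone0 k = {(x, y). k * x + y \<le> 0 \<and> k * x - y \<le> 0}"

definition zone1 :: "real \<Rightarrow> (real \<times> real) set" where
  "zone1 k = {(x, y). k * x + y \<le> 0 \<and> k * x - y > 0}"

definition zone2 :: "real \<Rightarrow> (real \<times> real) set" where
  "zone2 k = {(x, y). k * x + y > 0 \<and> k * x - y \<le> 0}"

definition zone12 :: "real \<Rightarrow> (real \<times> real) set" where
  "zone12 k = {(x, y). k * x + y > 0 \<and> k * x - y > 0}"

text \<open>The four zones partition the plane, so the last branch below is exactly the case \<open>zone12\<close>.\<close>

lemma zones_cover: "zone0 k \<union> zone1 k \<union> zone2 k \<union> zone12 k = UNIV"
  by (auto simp: zone0_def zone1_def zone2_def zone12_def)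

lemma zones_disjoint:
  "zone0 k \<inter> zone1 k = {}" "zone0 k \<inter> zone2 k = {}" "zone0 k \<inter> zone12 k = {}"
  "zone1 k \<inter> zone2 k = {}" "zone1 k \<inter> zone12 k = {}" "zone2 k \<inter> zone12 k = {}"
  by (auto simp: zone0_def zone1_def zone2_def zone12_def)

definition ideal_step :: "real \<Rightarrow> real \<times> real \<Rightarrow> real \<times> real" where
  "ideal_step k v = (let x = fst v; y = snd v in
     if v \<in> zone0 k then v
     else if v \<in> zone1 k then
       ((1 - k^2) / (1 + k^2) * x + 2 * k / (1 + k^2) * y,
        2 * k / (1 + k^2) * x - (1 - k^2) / (1 + k^2) * y)
     else if v \<in> zone2 k then
       ((1 - k^2) / (1 + k^2) * x - 2 * k / (1 + k^2) * y,
        - (2 * k / (1 + k^2)) * x - (1 - k^2) / (1 + k^2) * y)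
     else
       ((- (k^4) * x^2 + (1 - 2 * k^2) * y^2) / (k^4 * x^2 + y^2) * x,
        (k^2 * (k^2 - 2) * x^2 - y^2) / (k^4 * x^2 + y^2) * y))"

definition ideal_sequence :: "real \<Rightarrow> (nat \<Rightarrow> real \<times> real) \<Rightarrow> bool" where
  "ideal_sequence k v \<longleftrightarrow> (\<forall>n. v (Suc n) = ideal_step k (v n))"

end

theory Submission
  imports Defs
begin

text \<open>
  Write \<open>n\<^sub>1 = (k, 1)\<close> and \<open>n\<^sub>2 = (k, -1)\<close> for the (unnormalised) wall normals, so that
  \<open>zone12 k\<close> is the set of velocities whose inner products \<open>p = k * x + y\<close> and \<open>m = k * x - y\<close>
  with both normals are positive. The multiple impact law is the specular reflection
  \<open>v' = v - 2 * (v \<bullet> w) / (w \<bullet> w) * w\<close> along the direction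
  \<open>w = (k\<^sup>2 * x, y) = (p * n\<^sub>1 + m * n\<^sub>2) / 2\<close>, which weighs each wall by the velocity with which it
  is hit. A reflection reverses the component along \<open>w\<close>, hence \<open>v' \<bullet> w = - (v \<bullet> w)\<close>. On
  \<open>zone12 k\<close> the vector \<open>w\<close> is a positive combination of the normals, so \<open>v \<bullet> w > 0\<close>, and any
  velocity in \<open>zone12 k\<close> has positive inner product with \<open>w\<close>. As \<open>v' \<bullet> w\<close> is negative, \<open>v'\<close> cannot
  lie in \<open>zone12 k\<close>.
\<close>

lemma ideal_step_zone12:
  assumes "(x, y) \<in> zone12 k"
  shows "ideal_step k (x, y) =
    ((- (k^4) * x^2 + (1 - 2 * k^2) * y^2) / (k^4 * x^2 + y^2) * x,
     (k^2 * (k^2 - 2) * x^2 - y^2) / (k^4 * x^2 + y^2) * y)"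
  using assms zones_disjoint[of k] by (auto simp: ideal_step_def)

text \<open>
  The sign reversal \<open>v' \<bullet> w = - (v \<bullet> w)\<close> for \<open>w = (k\<^sup>2 * x, y)\<close>. The denominator of the impact law
  is \<open>w \<bullet> w\<close>, which is nonzero because \<open>w = 0\<close> would force \<open>k * x = y = 0\<close>.
\<close>

lemma multiple_impact_reverses_impulse_component:
  assumes "(x, y) \<in> zone12 k" and "ideal_step k (x, y) = (x', y')"
  shows "k^2 * x * x' + y * y' = - (k^2 * x^2 + y^2)"
proof -
  define D where "D = k^4 * x^2 + y^2"
  have "k * x > 0"
    using assms(1) by (simp add: zone12_def)
  then have "k^4 * x^2 > 0"
    by (auto simp: zero_less_mult_iff)
  then have "D > 0"
    unfolding D_def by (simp add: add_pos_nonneg)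
  have x': "D * x' = (- (k^4) * x^2 + (1 - 2 * k^2) * y^2) * x"
    and y': "D * y' = (k^2 * (k^2 - 2) * x^2 - y^2) * y"
    using assms(2) ideal_step_zone12[OF assms(1)] \<open>D > 0\<close>
    by (auto simp: D_def[symmetric])
  have "D * (k^2 * x * x' + y * y') = k^2 * x * (D * x') + y * (D * y')"
    by (simp add: algebra_simps)
  also have "\<dots> = D * (- (k^2 * x^2 + y^2))"
    unfolding x' y' unfolding D_def by algebra
  finally show ?thesis
    using \<open>D > 0\<close> by simp
qed

lemma ideal_step_leaves_zone12:
  assumes "v \<in> zone12 k"
  shows "ideal_step k v \<notin> zone12 k"
proof
  assume after: "ideal_step k v \<in> zone12 k"
  obtain x y where v: "v = (x, y)"
    by (cases v)
  obtain x' y' where step: "ideal_step k (x, y) = (x', y')"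
    by (cases "ideal_step k (x, y)")
  have pos: "k * x + y > 0" "k * x - y > 0" "k * x' + y' > 0" "k * x' - y' > 0"
    using assms after by (auto simp: v step zone12_def)
  \<comment> \<open>Both sides are \<open>2 * (v' \<bullet> w)\<close>, the left one with \<open>w\<close> expanded in the wall normals.\<close>
  have "(k * x + y) * (k * x' + y') + (k * x - y) * (k * x' - y') = 2 * (k^2 * x * x' + y * y')"
    by algebra
  also have "\<dots> = - (2 * (k^2 * x^2 + y^2))"
    using multiple_impact_reverses_impulse_component[OF assms[unfolded v] step] by simp
  also have "\<dots> \<le> 0"
    by (simp add: add_nonneg_nonneg del: minus_add_distrib)
  finally show False
    using pos by (smt (verit) mult_pos_pos)
qed

theorem theorem3p1:
  fixes \<alpha> k :: real and v :: "nat \<Rightarrow> real \<times> real"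
  assumes "0 < 2 * \<alpha>" and "2 * \<alpha> < pi"
    and "k = tan \<alpha>"
    and "ideal_sequence k v"
  shows "\<forall>n. v n \<in> zone12 k \<longrightarrow> v (Suc n) \<notin> zone12 k"
  using assms(4) ideal_step_leaves_zone12 by (simp add: ideal_sequence_def)

end
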